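(* If $V\in\{0,1\}^{\mathbb{N}}$ is an infinite word with a finite spacer rank construction (that is, $V$ has a spacer rank-$n$ construction for some $n\ge1$), then the topological entropy of $(X_V,\sigma)$ is $0$.
   Context: Building: $\mathbb{N}$ is the set of nonnegative integers; $\mathcal{F}$ is the set of all finite binary words that start and end with $0$; $1^a$ is $a$ consecutive $1$s. For finite $S\subset\mathcal{F}$, a finite word $w$ is built from $S$ if $w=v_11^{a_1}v_21^{a_2}\cdots v_k1^{a_k}v_{k+1}$ for some $k\ge 1$, $v_i\in S$, $a_i\in\mathbb{N}$; it is built from $S$ starting with $u$ if moreover one can take $v_1=u$. An infinite word $V$ has an at most spacer rank-$n$ construction if there are finite sets $S_i=\{v_{i,1},\dots,v_{i,n_i}\}\subset\mathcal{F}$ ($i\in\mathbb{N}$) with $1\le n_i\le n$ such that: $v_{0,j}=0$ for all $j$; $v_{i+1,1}$ is built from $S_i$ starting with $v_{i,1}$; $v_{i+1,j}$ is built from $S_i$ for all $2\le j\le n_{i+1}$; and $v_{i,1}$ is an initial segment of $V$ for all $i$. For $n>1$, $V$ has a spacer rank-$n$ construction if it has an at most spacer rank-$n$ construction and not an at most spacer rank-$(n-1)$ construction; a spacer rank-$1$ construction is an at most spacer rank-$1$ construction. Subshift: $X_V=\{x\in\{0,1\}^{\mathbb{Z}}:\text{every finite subword of }x\text{ is a subword of }V\}$, with the shift $\sigma(x)(i)=x(i+1)$. The topological entropy of $(X_V,\sigma)$ is $\lim_{n\to\infty}\frac{\ln P_n(X_V)}{n}$, where $P_n(X_V)$ is the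 number of words of length $n$ that occur in some $x\in X_V$. *)

theory Defs
  imports "HOL-Analysis.Analysis" "HOL-Library.Z2"
begin

type_synonym word = "bit list"

definition zero_ended :: "word set" where
  "zero_ended = {w. w \<noteq> [] \<and> hd w = 0 \<and> last w = 0}"

text \<open>
  The word $v_1 1^{a_1} v_2 1^{a_2} \cdots v_k 1^{a_k} v_{k+1}$. Families of words are indexed
  from 1; the values of \<open>v\<close> and \<open>a\<close> at 0 are irrelevant.
\<close>

definition spaced_concat :: "nat \<Rightarrow> (nat \<Rightarrow> word) \<Rightarrow> (nat \<Rightarrow> nat) \<Rightarrow> word" where
  "spaced_concat k v a = concat (map (\<lambda>i. v i @ replicate (a i) 1) [1..<k+1]) @ v (k+1)"

definition built_from :: "word set \<Rightarrow> word \<Rightarrow> bool" where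
  "built_from S w \<longleftrightarrow>
     (\<exists>k\<ge>1. \<exists>v a. (\<forall>i\<in>{1..k+1}. v i \<in> S) \<and> w = spaced_concat k v a)"

definition built_from_starting_with :: "word set \<Rightarrow> word \<Rightarrow> word \<Rightarrow> bool" where
  "built_from_starting_with S u w \<longleftrightarrow>
     (\<exists>k\<ge>1. \<exists>v a. (\<forall>i\<in>{1..k+1}. v i \<in> S) \<and> v 1 = u \<and> w = spaced_concat k v a)"

definition subword :: "word \<Rightarrow> (nat \<Rightarrow> bit) \<Rightarrow> bool" where
  "subword w V \<longleftrightarrow> (\<exists>i. w = map (\<lambda>j. V (i + j)) [0..<length w])"

definition initial_segment :: "word \<Rightarrow> (nat \<Rightarrow> bit) \<Rightarrow> bool" where
  "initial_segment w V \<longleftrightarrow> w = map V [0..<length w]"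

definition subword_biinf :: "word \<Rightarrow> (int \<Rightarrow> bit) \<Rightarrow> bool" where
  "subword_biinf w x \<longleftrightarrow> (\<exists>i. w = map (\<lambda>j. x (i + int j)) [0..<length w])"

text \<open>
  Here \<open>N i\<close> is the number $n_i$ of words at level \<open>i\<close>, and \<open>v i ` {1..N i}\<close> is the set
  $S_i = \{v_{i,1}, \dots, v_{i,n_i}\}$; repetitions among the \<open>v i j\<close> are allowed.
\<close>

definition at_most_spacer_rank :: "nat \<Rightarrow> (nat \<Rightarrow> bit) \<Rightarrow> bool" where
  "at_most_spacer_rank n V \<longleftrightarrow>
     (\<exists>(N :: nat \<Rightarrow> nat) (v :: nat \<Rightarrow> nat \<Rightarrow> word).
        (\<forall>i. 1 \<le> N i \<and> N i \<le> n) \<and>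
        (\<forall>i. v i ` {1..N i} \<subseteq> zero_ended) \<and>
        (\<forall>j\<in>{1..N 0}. v 0 j = [0]) \<and>
        (\<forall>i. built_from_starting_with (v i ` {1..N i}) (v i 1) (v (i+1) 1)) \<and>
        (\<forall>i. \<forall>j\<in>{2..N (i+1)}. built_from (v i ` {1..N i}) (v (i+1) j)) \<and>
        (\<forall>i. initial_segment (v i 1) V))"

definition spacer_rank :: "nat \<Rightarrow> (nat \<Rightarrow> bit) \<Rightarrow> bool" where
  "spacer_rank n V \<longleftrightarrow>
     n = 1 \<and> at_most_spacer_rank 1 V \<or>
     n > 1 \<and> at_most_spacer_rank n V \<and> \<not> at_most_spacer_rank (n - 1) V"

definition subshift :: "(nat \<Rightarrow> bit) \<Rightarrow> (int \<Rightarrow> bit) set" where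
  "subshift V = {x. \<forall>w. subword_biinf w x \<longrightarrow> subword w V}"

definition shift :: "(int \<Rightarrow> bit) \<Rightarrow> (int \<Rightarrow> bit)" where
  "shift x = (\<lambda>i. x (i + 1))"

lemma subword_biinf_shift: "subword_biinf w (shift x) \<longleftrightarrow> subword_biinf w x"
proof
  assume "subword_biinf w (shift x)"
  then obtain i where "w = map (\<lambda>j. x ((i + 1) + int j)) [0..<length w]"
    unfolding subword_biinf_def shift_def by (auto simp: algebra_simps)
  then show "subword_biinf w x" unfolding subword_biinf_def by blast
next
  assume "subword_biinf w x"
  then obtain i where "w = map (\<lambda>j. x (i + int j)) [0..<length w]"
    unfolding subword_biinf_def by blast
  then have "w = map (\<lambda>j. shift x ((i - 1) + int j)) [0..<length w]"
    by (simp add: shift_def algebra_simps)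
  then show "subword_biinf w (shift x)" unfolding subword_biinf_def by blast
qed

lemma shift_in_subshift_iff: "shift x \<in> subshift V \<longleftrightarrow> x \<in> subshift V"
  by (simp add: subshift_def subword_biinf_shift)

definition num_words :: "(int \<Rightarrow> bit) set \<Rightarrow> nat \<Rightarrow> nat" where
  "num_words X n = card {w. length w = n \<and> (\<exists>x\<in>X. subword_biinf w x)}"

text \<open>
  Topological entropy of a subshift \<open>X\<close> under \<open>shift\<close>, as the exponential growth rate
  of its word counts. It is a relation so that stating a value includes the existence of the limit.
\<close>

definition has_topological_entropy :: "(int \<Rightarrow> bit) set \<Rightarrow> real \<Rightarrow> bool" where
  "has_topological_entropy X h \<longleftrightarrow>
     (\<lambda>n. ln (real (num_words X n)) / real n) \<longlonglongrightarrow> h"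

end

theory Submission
  imports Defs "HOL-Real_Asymp.Real_Asymp"
begin

text \<open>
  Words of level \<open>i\<close> have length at least \<open>L = 2 ^ i\<close>, and every subword of \<open>V\<close> can be read while
  parsing \<open>V\<close> into words of level \<open>i\<close> and single spacers. During \<open>L\<close> consecutive letters at most one
  word of level \<open>i\<close> begins, so, given what is left of the current word, there are at most \<open>1 + n L\<close>
  ways to read on. Hence the number of subwords of length \<open>m\<close> is at most
  \<open>C * (1 + n L) ^ (m div L)\<close> with \<open>C\<close> depending only on \<open>i\<close>, so the upper growth rate is at most
  \<open>ln (1 + n L) / L\<close>, which tends to 0 as \<open>i\<close> grows.
\<close>

section \<open>Counting the words that can be read on from a given rest\<close>

text \<open>The words of length \<open>m\<close> that can be read when \<open>r\<close> is the unread rest of the current word.\<close>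

definition continuations :: "word set \<Rightarrow> word \<Rightarrow> nat \<Rightarrow> word set" where
  "continuations S r m =
     {take m (r @ concat l) |l. l \<in> lists (insert [1] S) \<and> m \<le> length (r @ concat l)}"

lemma continuationsI:
  "l \<in> lists (insert [1] S) \<Longrightarrow> m \<le> length (r @ concat l) \<Longrightarrow>
   take m (r @ concat l) \<in> continuations S r m"
  unfolding continuations_def by blast

lemma finite_UNIV_bit: "finite (UNIV :: bit set)" and card_UNIV_bit: "card (UNIV :: bit set) = 2"
proof -
  have eq: "(UNIV :: bit set) = {0, 1}" using bit_not_zero_iff by blast
  show "finite (UNIV :: bit set)" "card (UNIV :: bit set) = 2" unfolding eq by simp_all
qed

lemma finite_bit_words: "finite {w :: word. length w = m}"
  using finite_lists_length_eq[of "UNIV :: bit set" m] by (simp add: finite_UNIV_bit)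

lemma card_bit_words: "card {w :: word. length w = m} = 2 ^ m"
  using card_lists_length_eq[of "UNIV :: bit set" m] by (simp add: finite_UNIV_bit card_UNIV_bit)

lemma continuations_subset: "continuations S r m \<subseteq> {w. length w = m}"
  unfolding continuations_def by auto

lemma finite_continuations: "finite (continuations S r m)"
  by (rule finite_subset[OF continuations_subset finite_bit_words])

text \<open>Spacers are absorbed into \<open>r\<close> one at a time until \<open>L\<close> letters
  are filled or a word \<open>v\<close> of \<open>S\<close> begins. Since \<open>v\<close> has
  length at least \<open>L\<close>, it reaches the end of this window, so \<open>v\<close> and the
  number \<open>p\<close> of spacers before it determine both the window and the new rest.\<close>

lemma parse_step:
  assumes long: "\<And>v. v \<in> S \<Longrightarrow> L \<le> length v"
    and "l \<in> lists (insert [1] S)" "length r \<le> L" "L \<le> length (r @ concat l)"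
  shows "\<exists>l'\<in>lists (insert [1] S).
     r @ concat l = (r @ replicate (L - length r) 1) @ concat l' \<or>
     (\<exists>v\<in>S. \<exists>p<L - length r.
        r @ concat l = (r @ replicate p 1 @ take (L - length r - p) v)
          @ drop (L - length r - p) v @ concat l')"
  using assms(2-)
proof (induction l arbitrary: r rule: list.induct)
  case Nil
  then show ?case by (auto intro!: bexI[of _ "[]"])
next
  case (Cons u l)
  show ?case
  proof (cases "length r = L")
    \<comment> \<open>The window is already full, so zero spacers are appended and nothing of the
      list is consumed.\<close>
    case True
    then have "r @ concat (u # l) = (r @ replicate (L - length r) 1) @ concat (u # l)" by simp
    with Cons.prems(1) show ?thesis by blast
  next
    case False
    with Cons.prems have lt: "length r < L" by simp
    show ?thesis
    proof (cases "u \<in> S")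
      \<comment> \<open>A word of \<open>S\<close> begins right after \<open>r\<close>: the second
        alternative with \<open>p = 0\<close>.\<close>
      case True
      have "r @ concat (u # l) = (r @ replicate 0 1 @ take (L - length r - 0) u)
          @ drop (L - length r - 0) u @ concat l" by simp
      with True lt Cons.prems(1) show ?thesis by (metis Cons_in_lists_iff zero_less_diff)
    next
      case False
      with Cons.prems have u: "u = [1]" by simp
      \<comment> \<open>The spacer joins the rest, and the induction hypothesis is applied to
        \<open>r @ [1]\<close>; below, its spacer counts go up by one when seen from
        \<open>r\<close>.\<close>
      obtain l' where l': "l' \<in> lists (insert [1] S)"
        and c: "(r @ [1]) @ concat l = ((r @ [1]) @ replicate (L - length (r @ [1])) 1) @ concat l' \<or>
          (\<exists>v\<in>S. \<exists>p<L - length (r @ [1]).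
            (r @ [1]) @ concat l = ((r @ [1]) @ replicate p 1 @ take (L - length (r @ [1]) - p) v)
              @ drop (L - length (r @ [1]) - p) v @ concat l')"
        using Cons.IH[of "r @ [1]"] Cons.prems lt u by auto
      from c show ?thesis
      proof (elim disjE bexE exE conjE)
        assume e: "(r @ [1]) @ concat l
          = ((r @ [1]) @ replicate (L - length (r @ [1])) 1) @ concat l'"
        have "L - length r = Suc (L - length (r @ [1]))" using lt by simp
        then have "r @ concat (u # l) = (r @ replicate (L - length r) 1) @ concat l'"
          using e u by simp
        then show ?thesis using l' by blast
      next
        fix v p
        assume v: "v \<in> S" and p: "p < L - length (r @ [1])"
          and e: "(r @ [1]) @ concat l
            = ((r @ [1]) @ replicate p 1 @ take (L - length (r @ [1]) - p) v)
              @ drop (L - length (r @ [1]) - p) v @ concat l'"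
        have "r @ concat (u # l) = (r @ replicate (Suc p) 1 @ take (L - length r - Suc p) v)
            @ drop (L - length r - Suc p) v @ concat l'" "Suc p < L - length r"
          using e u p by simp_all
        then show ?thesis using l' v by blast
      qed
    qed
  qed
qed

lemma continuations_add_subset:
  assumes long: "\<And>v. v \<in> S \<Longrightarrow> L \<le> length v" and "length r \<le> L"
  shows "continuations S r (L + m) \<subseteq>
     (@) (r @ replicate (L - length r) 1) ` continuations S [] m \<union>
     (\<Union>(v, p)\<in>S \<times> {..<L - length r}.
        (@) (r @ replicate p 1 @ take (L - length r - p) v)
          ` continuations S (drop (L - length r - p) v) m)"
proof
  fix w assume "w \<in> continuations S r (L + m)"
  then obtain l where l: "l \<in> lists (insert [1] S)" and len: "L + m \<le> length (r @ concat l)"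
    and w: "w = take (L + m) (r @ concat l)"
    unfolding continuations_def by blast
  have "L \<le> length (r @ concat l)" using len by simp
  from parse_step[OF long l \<open>length r \<le> L\<close> this] obtain l' where l': "l' \<in> lists (insert [1] S)"
    and c: "r @ concat l = (r @ replicate (L - length r) 1) @ concat l' \<or>
     (\<exists>v\<in>S. \<exists>p<L - length r.
        r @ concat l = (r @ replicate p 1 @ take (L - length r - p) v)
          @ drop (L - length r - p) v @ concat l')" by blast
  \<comment> \<open>Any factorization whose first factor has length exactly \<open>L\<close> cuts
    \<open>w\<close> at the end of the window and leaves enough letters for a continuation of length
    \<open>m\<close>.\<close>
  have split: "w = u @ take m t" "m \<le> length t"
    if "r @ concat l = u @ t" "length u = L" for u t
    using that len w by simp_all
  from c show "w \<in> (@) (r @ replicate (L - length r) 1) ` continuations S [] m \<union>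
     (\<Union>(v, p)\<in>S \<times> {..<L - length r}.
        (@) (r @ replicate p 1 @ take (L - length r - p) v)
          ` continuations S (drop (L - length r - p) v) m)"
  proof (elim disjE bexE exE conjE)
    assume e: "r @ concat l = (r @ replicate (L - length r) 1) @ concat l'"
    from split[OF e] \<open>length r \<le> L\<close> show ?thesis
      using continuationsI[OF l', of m "[]"] by auto
  next
    fix v p
    assume v: "v \<in> S" and p: "p < L - length r"
      and e: "r @ concat l = (r @ replicate p 1 @ take (L - length r - p) v)
          @ drop (L - length r - p) v @ concat l'"
    have "length (r @ replicate p 1 @ take (L - length r - p) v) = L"
      using long[OF v] p by simp
    from split[OF e this] have "w \<in> (@) (r @ replicate p 1 @ take (L - length r - p) v)
          ` continuations S (drop (L - length r - p) v) m"
      using continuationsI[OF l'] by blast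
    with v p show ?thesis by blast
  qed
qed

text \<open>A rest that covers the whole window leaves no choice within it.\<close>

lemma continuations_add_subset_long:
  assumes "L \<le> length r"
  shows "continuations S r (L + m) \<subseteq> (@) (take L r) ` continuations S (drop L r) m"
proof
  fix w assume "w \<in> continuations S r (L + m)"
  then obtain l where l: "l \<in> lists (insert [1] S)" and len: "L + m \<le> length (r @ concat l)"
    and w: "w = take (L + m) (r @ concat l)"
    unfolding continuations_def by blast
  have "w = take L (r @ concat l) @ take m (drop L (r @ concat l))"
    unfolding w by (rule take_add)
  then have "w = take L r @ take m (drop L r @ concat l)"
    using assms by simp
  then show "w \<in> (@) (take L r) ` continuations S (drop L r) m"
    using continuationsI[OF l, of m "drop L r"] len assms by simp
qed

text \<open>For a short rest there is one branch in which no new word begins, and one for each pair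
  of a word and a spacer count; a long rest gives a single branch. Each branch leaves a rest of its
  own, which is why \<open>bound\<close> has to be uniform in \<open>r\<close>.\<close>

lemma card_continuations_add_le:
  assumes long: "\<And>v. v \<in> S \<Longrightarrow> L \<le> length v" and fin: "finite S" and card: "card S \<le> n"
    and bound: "\<And>r. card (continuations S r m) \<le> B"
  shows "card (continuations S r (L + m)) \<le> (1 + n * L) * B"
proof (cases "length r \<le> L")
  case True
  let ?A = "(@) (r @ replicate (L - length r) 1) ` continuations S [] m"
  let ?D = "\<lambda>(v, p). (@) (r @ replicate p 1 @ take (L - length r - p) v)
          ` continuations S (drop (L - length r - p) v) m"
  let ?I = "S \<times> {..<L - length r}"
  have img: "card ((@) u ` continuations S r' m) \<le> B" for u r'
    using card_image_le[OF finite_continuations] bound le_trans by blast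
  have "card (continuations S r (L + m)) \<le> card (?A \<union> (\<Union>x\<in>?I. ?D x))"
    using continuations_add_subset[OF long True] fin
    by (intro card_mono) (auto intro!: finite_continuations)
  also have "\<dots> \<le> card ?A + card (\<Union>x\<in>?I. ?D x)" by (rule card_Un_le)
  also have "card (\<Union>x\<in>?I. ?D x) \<le> (\<Sum>x\<in>?I. card (?D x))"
    using fin by (intro card_UN_le) simp
  also have "\<dots> \<le> (\<Sum>x\<in>?I. B)"
    by (intro sum_mono) (simp only: split_beta img)
  also have "\<dots> = card S * (L - length r) * B" using fin by (simp add: card_cartesian_product)
  also have "\<dots> \<le> n * L * B" using card by (intro mult_mono) auto
  finally show ?thesis using img[of "r @ replicate (L - length r) 1" "[]"] by simp
next
  case False
  then have "card (continuations S r (L + m)) \<le> card ((@) (take L r) ` continuations S (drop L r) m)"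
    by (intro card_mono continuations_add_subset_long finite_imageI finite_continuations) simp
  also have "\<dots> \<le> card (continuations S (drop L r) m)"
    by (rule card_image_le[OF finite_continuations])
  also have "\<dots> \<le> B" by (rule bound)
  also have "\<dots> \<le> (1 + n * L) * B" by simp
  finally show ?thesis .
qed

lemma card_continuations_le:
  assumes long: "\<And>v. v \<in> S \<Longrightarrow> L \<le> length v" and fin: "finite S" and card: "card S \<le> n"
  shows "card (continuations S r m) \<le> (1 + n * L) ^ (m div L) * 2 ^ (m mod L)"
proof -
  \<comment> \<open>Each of the \<open>q\<close> full windows costs one factor
    \<open>1 + n * L\<close>; the \<open>s\<close> letters at the end are bounded by the count of
    all binary words.\<close>
  have "card (continuations S r (q * L + s)) \<le> (1 + n * L) ^ q * 2 ^ s" for q s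
  proof (induction q arbitrary: r)
    case 0
    show ?case
      using card_mono[OF finite_bit_words continuations_subset, of S r s] by (simp add: card_bit_words)
  next
    case (Suc q)
    show ?case
      using card_continuations_add_le[OF long fin card Suc.IH, of r] by (simp add: algebra_simps)
  qed
  from this[of "m div L" "m mod L"] show ?thesis by simp
qed

section \<open>Parsing the subwords of \<open>V\<close> into words of a fixed level and
  spacers\<close>

text \<open>Reading may start in the middle of a block \<open>s\<close>, whose tail becomes the
  first rest. The empty block covers the case where \<open>p\<close> exceeds the total
  length.\<close>

lemma drop_concat:
  obtains s k l' where "s \<in> insert [] (set l)" "k \<le> length s"
    "set l' \<subseteq> set l" "drop p (concat l) = drop k s @ concat l'"
proof -
  have "\<exists>s\<in>insert [] (set l). \<exists>k\<le>length s. \<exists>l'. set l' \<subseteq> set l \<and>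
      drop p (concat l) = drop k s @ concat l'"
  proof (induction l arbitrary: p)
    case Nil
    then show ?case by auto
  next
    case (Cons u l)
    show ?case
    proof (cases "p \<le> length u")
      case True
      then have "drop p (concat (u # l)) = drop p u @ concat l" by simp
      with True show ?thesis by (metis insertCI list.set_intros(1) set_subset_Cons)
    next
      case False
      then have "drop p (concat (u # l)) = drop (p - length u) (concat l)" by simp
      then show ?thesis
        using Cons.IH[of "p - length u"] by (metis insert_iff list.simps(15) subset_insertI2)
    qed
  qed
  then show ?thesis using that by blast
qed

lemma concat_lists_append:
  assumes "x \<in> concat ` lists T" "y \<in> concat ` lists T"
  shows "x @ y \<in> concat ` lists T"
proof -
  from assms obtain k l where "k \<in> lists T" "l \<in> lists T" "x = concat k" "y = concat l" by blast
  then have "x @ y = concat (k @ l)" "k @ l \<in> lists T" by auto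
  then show ?thesis by blast
qed

lemma concat_lists_concat:
  assumes "set xs \<subseteq> concat ` lists T"
  shows "concat xs \<in> concat ` lists T"
  using assms
proof (induction xs)
  case Nil
  show ?case by (rule image_eqI[of _ _ "[]"]) auto
next
  case (Cons x xs)
  then show ?case by (simp add: concat_lists_append)
qed

text \<open>The concatenations of lists over \<open>T\<close> form the submonoid generated by
  \<open>T\<close>. Once this submonoid contains one level and the single spacer, it contains the
  next level too.\<close>

lemma built_from_concat_lists:
  assumes "built_from S w" and S: "S \<subseteq> concat ` lists T" and one: "[1] \<in> T"
  shows "w \<in> concat ` lists T"
proof -
  from assms(1) obtain k v a where k: "k \<ge> 1" and v: "\<And>i. i \<in> {1..k+1} \<Longrightarrow> v i \<in> S"
    and w: "w = spaced_concat k v a"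
    unfolding built_from_def by blast
  have ones: "replicate c 1 \<in> concat ` lists T" for c
  proof (rule image_eqI)
    show "replicate c 1 = concat (replicate c [1])" by (induction c) auto
    show "replicate c [1] \<in> lists T" using one by auto
  qed
  have "v i @ replicate (a i) 1 \<in> concat ` lists T" if "i \<in> {1..<k+1}" for i
    using v[of i] S that by (intro concat_lists_append ones) auto
  then show ?thesis
    unfolding w spaced_concat_def using v[of "k+1"] S
    by (intro concat_lists_append concat_lists_concat) auto
qed

text \<open>Since \<open>k\<close> is at least 1, the first and the last word are separate summands
  of the length. Lengths thus at least double from level to level, which gives the
  \<open>2 ^ i\<close>.\<close>

lemma built_from_length:
  assumes "built_from S w" and long: "\<And>v. v \<in> S \<Longrightarrow> L \<le> length v"
  shows "2 * L \<le> length w"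
proof -
  from assms(1) obtain k v a where k: "k \<ge> 1" and v: "\<And>i. i \<in> {1..k+1} \<Longrightarrow> v i \<in> S"
    and w: "w = spaced_concat k v a"
    unfolding built_from_def by blast
  have "[1..<k+1] = 1 # [2..<k+1]" using k by (simp add: upt_conv_Cons numeral_2_eq_2)
  then have "length w \<ge> length (v 1) + length (v (k+1))"
    unfolding w spaced_concat_def by simp
  then show ?thesis using long[OF v[of 1]] long[OF v[of "k+1"]] k by simp
qed

lemma built_from_starting_with_imp_built_from:
  "built_from_starting_with S u w \<Longrightarrow> built_from S w"
  unfolding built_from_starting_with_def built_from_def by blast

text \<open>A subword of \<open>V\<close> lies in a prefix of a high level, which parses into words
  of level \<open>i\<close> and spacers. The constant \<open>C\<close> accounts for the rest with
  which reading starts and for the incomplete last window.\<close>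

lemma card_subwords_le:
  assumes "at_most_spacer_rank n V"
  shows "\<exists>C. \<forall>m. card {w. length w = m \<and> subword w V} \<le> C * (1 + n * 2 ^ i) ^ (m div 2 ^ i)"
proof -
  from assms obtain N :: "nat \<Rightarrow> nat" and v :: "nat \<Rightarrow> nat \<Rightarrow> word"
    where N: "\<forall>i. 1 \<le> N i \<and> N i \<le> n"
    and v0: "\<forall>j\<in>{1..N 0}. v 0 j = [0]"
    and first: "\<forall>i. built_from_starting_with (v i ` {1..N i}) (v i 1) (v (i+1) 1)"
    and other: "\<forall>i. \<forall>j\<in>{2..N (i+1)}. built_from (v i ` {1..N i}) (v (i+1) j)"
    and init: "\<forall>i. initial_segment (v i 1) V"
    unfolding at_most_spacer_rank_def by (elim exE conjE)
  define W where "W i = v i ` {1..N i}" for i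
  have built: "built_from (W i) x" if "x \<in> W (Suc i)" for i x
  proof -
    from that obtain j where j: "j \<in> {1..N (i+1)}" "x = v (i+1) j" by (auto simp: W_def)
    show ?thesis
    proof (cases "j = 1")
      case True
      then show ?thesis
        using built_from_starting_with_imp_built_from[OF first[rule_format, of i]] j by (simp add: W_def)
    next
      case False
      then show ?thesis using other[rule_format, of j i] j by (simp add: W_def)
    qed
  qed
  have long: "2 ^ i \<le> length x" if "x \<in> W i" for i x
    using that
  proof (induction i arbitrary: x)
    case 0
    then show ?case using v0 by (auto simp: W_def)
  next
    case (Suc i)
    then show ?case using built_from_length[OF built[OF Suc.prems] Suc.IH] by simp
  qed
  have fin: "finite (W i)" and card: "card (W i) \<le> n"
    using N card_image_le[of "{1..N i}" "v i"] le_trans[of _ "N i" n] by (auto simp: W_def)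
  define T where "T = insert [1] (W i)"
  have parse: "W (i + d) \<subseteq> concat ` lists T" for d
  proof (induction d)
    case 0
    show ?case
    proof
      fix x assume "x \<in> W (i + 0)"
      then have "[x] \<in> lists T" by (simp add: T_def)
      then show "x \<in> concat ` lists T" by (intro image_eqI[of _ _ "[x]"]) auto
    qed
  next
    case (Suc d)
    show ?case
    proof
      fix x assume "x \<in> W (i + Suc d)"
      then have "built_from (W (i + d)) x" using built by simp
      then show "x \<in> concat ` lists T"
        by (rule built_from_concat_lists[OF _ Suc.IH]) (simp add: T_def)
    qed
  qed
  \<comment> \<open>All tails of blocks, i.e. all possible first rests; this set is finite and
    independent of \<open>m\<close>.\<close>
  define R where "R = (\<Union>s\<in>insert [] T. (\<lambda>k. drop k s) ` {..length s})"
  have finR: "finite R" using fin by (simp add: R_def T_def)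
  have sub: "{w. length w = m \<and> subword w V} \<subseteq> (\<Union>r\<in>R. continuations (W i) r m)" for m
  proof
    fix w assume "w \<in> {w. length w = m \<and> subword w V}"
    then obtain p where m: "length w = m" and w: "w = map (\<lambda>j. V (p + j)) [0..<m]"
      unfolding subword_def by auto
    \<comment> \<open>The level is at least \<open>i\<close>, so \<open>?x\<close> can be parsed
      over \<open>T\<close>, and high enough that the prefix \<open>?x\<close> of \<open>V\<close>
      covers the positions up to \<open>p + m\<close>.\<close>
    let ?x = "v (i + (p + m)) 1"
    have x: "?x \<in> W (i + (p + m))" using N by (auto simp: W_def)
    have "p + m \<le> 2 ^ (i + (p + m))"
      by (meson le_add2 le_trans less_exp less_imp_le_nat)
    with long[OF x] have len: "p + m \<le> length ?x" by linarith
    have xV: "?x = map V [0..<length ?x]" using init unfolding initial_segment_def by blast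
    have wx: "w = take m (drop p ?x)"
    proof (rule nth_equalityI)
      show "length w = length (take m (drop p ?x))" using len m by simp
      fix j assume "j < length w"
      then have j: "j < m" using m by simp
      have "take m (drop p ?x) ! j = ?x ! (p + j)" using j len by simp
      also have "\<dots> = V (p + j)" by (subst xV) (use j len in simp)
      finally show "w ! j = take m (drop p ?x) ! j" using j by (simp add: w)
    qed
    obtain l where l: "l \<in> lists T" "?x = concat l" using parse x by blast
    obtain s k l' where s: "s \<in> insert [] (set l)" "k \<le> length s"
      and l': "set l' \<subseteq> set l" and d: "drop p (concat l) = drop k s @ concat l'"
      by (rule drop_concat)
    define r where "r = drop k s"
    note d = d[folded r_def]
    have "r \<in> R" unfolding R_def r_def using s l(1) by auto
    moreover have "w \<in> continuations (W i) r m"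
    proof -
      have "l' \<in> lists (insert [1] (W i))" using l' l(1) by (auto simp: T_def)
      moreover have "m \<le> length (r @ concat l')" using d l(2) len by (metis add_le_imp_le_diff add.commute length_drop)
      ultimately show ?thesis using continuationsI wx l(2) d by metis
    qed
    ultimately show "w \<in> (\<Union>r\<in>R. continuations (W i) r m)" by blast
  qed
  show ?thesis
  proof (intro exI allI)
    fix m
    let ?B = "(1 + n * 2 ^ i) ^ (m div 2 ^ i)"
    have "card {w. length w = m \<and> subword w V} \<le> card (\<Union>r\<in>R. continuations (W i) r m)"
      by (rule card_mono[OF _ sub]) (use finR finite_continuations in auto)
    also have "\<dots> \<le> (\<Sum>r\<in>R. card (continuations (W i) r m))"
      by (rule card_UN_le[OF finR])
    also have "\<dots> \<le> (\<Sum>r\<in>R. ?B * 2 ^ 2 ^ i)"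
    proof (rule sum_mono)
      fix r
      have "card (continuations (W i) r m) \<le> ?B * 2 ^ (m mod 2 ^ i)"
        by (rule card_continuations_le[OF long fin card])
      \<comment> \<open>The remainder is below \<open>2 ^ i\<close>, so its factor is absorbed into
        a constant free of \<open>m\<close>.\<close>
      also have "\<dots> \<le> ?B * 2 ^ 2 ^ i"
        by (intro mult_le_mono2 power_increasing less_imp_le_nat) auto
      finally show "card (continuations (W i) r m) \<le> ?B * 2 ^ 2 ^ i" .
    qed
    also have "\<dots> = (card R * 2 ^ 2 ^ i) * ?B" by simp
    finally show "card {w. length w = m \<and> subword w V} \<le> (card R * 2 ^ 2 ^ i) * ?B" .
  qed
qed

section \<open>From the word count to the entropy\<close>

lemma num_words_subshift_le: "num_words (subshift V) m \<le> card {w. length w = m \<and> subword w V}"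
  unfolding num_words_def
  by (rule card_mono) (auto simp: subshift_def intro: finite_subset[OF _ finite_bit_words[of m]])

text \<open>At \<open>k = 0\<close> this rests on the convention \<open>ln 0 = 0\<close>.\<close>

lemma ln_of_nat_nonneg: "0 \<le> ln (real k)"
  by (cases k) auto

text \<open>The level \<open>i\<close> is fixed first, with
  \<open>ln (1 + n * 2 ^ i) / 2 ^ i\<close> below \<open>e\<close>. As \<open>m\<close> grows, the
  constant \<open>C\<close> for that level then contributes only a term of order
  \<open>1 / m\<close>.\<close>

lemma zero_growth_rate:
  fixes P :: "nat \<Rightarrow> nat"
  assumes bound: "\<And>i. \<exists>C. \<forall>m. P m \<le> C * (1 + n * 2 ^ i) ^ (m div 2 ^ i)"
  shows "(\<lambda>m. ln (real (P m)) / real m) \<longlonglongrightarrow> 0"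
proof (rule tendstoI)
  fix e :: real assume e: "e > 0"
  have "(\<lambda>i. ln (1 + real n * 2 ^ i) / 2 ^ i) \<longlonglongrightarrow> 0"
    by (cases "n = 0") (simp, real_asymp)
  then have "eventually (\<lambda>i. ln (1 + real n * 2 ^ i) / 2 ^ i < e) sequentially"
    using e by (rule order_tendstoD(2))
  then obtain i where i: "ln (1 + real n * 2 ^ i) / 2 ^ i < e"
    by (auto simp: eventually_sequentially)
  define b where "b = ln (1 + real n * 2 ^ i)"
  have b: "b \<ge> 0" by (simp add: b_def)
  obtain C where C: "\<And>m. P m \<le> C * (1 + n * 2 ^ i) ^ (m div 2 ^ i)" using bound by blast
  \<comment> \<open>Passing from \<open>C\<close> to \<open>Suc C\<close> keeps the logarithm of the
    constant defined and nonnegative; the latter settles the case \<open>P m = 0\<close>, where the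
    left side is 0 by convention.\<close>
  have upper: "ln (real (P m)) / real m \<le> ln (real (Suc C)) / real m + b / 2 ^ i" if "m > 0" for m
  proof (cases "P m = 0")
    case True
    then show ?thesis using b by simp
  next
    case False
    have "P m \<le> Suc C * (1 + n * 2 ^ i) ^ (m div 2 ^ i)" using C[of m] by simp
    then have "real (P m) \<le> real (Suc C) * (1 + real n * 2 ^ i) ^ (m div 2 ^ i)"
      by (metis (mono_tags, lifting) of_nat_1 of_nat_add of_nat_le_iff of_nat_mult of_nat_numeral of_nat_power)
    then have "ln (real (P m)) \<le> ln (real (Suc C) * (1 + real n * 2 ^ i) ^ (m div 2 ^ i))"
      using False by (subst ln_le_cancel_iff) (auto intro!: mult_pos_pos zero_less_power add_pos_nonneg)
    also have "\<dots> = ln (real (Suc C)) + ln ((1 + real n * 2 ^ i) ^ (m div 2 ^ i))"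
      by (intro ln_mult_pos zero_less_power add_pos_nonneg) auto
    also have "\<dots> = ln (real (Suc C)) + real (m div 2 ^ i) * b"
      unfolding b_def by (subst ln_realpow) (auto intro: add_pos_nonneg)
    also have "real (m div 2 ^ i) \<le> real m / 2 ^ i"
      using of_nat_div_le_of_nat[of m "2 ^ i", where 'a = real] by simp
    finally have "ln (real (P m)) \<le> ln (real (Suc C)) + real m / 2 ^ i * b"
      using b by (simp add: mult_right_mono)
    then show ?thesis using that by (simp add: field_simps)
  qed
  have "(\<lambda>m. ln (real (Suc C)) / real m + b / 2 ^ i) \<longlonglongrightarrow> 0 + b / 2 ^ i"
    by (intro tendsto_add tendsto_const lim_const_over_n)
  then have "eventually (\<lambda>m. ln (real (Suc C)) / real m + b / 2 ^ i < e) sequentially"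
    by (rule order_tendstoD(2)) (use i in \<open>simp add: b_def\<close>)
  then show "eventually (\<lambda>m. dist (ln (real (P m)) / real m) 0 < e) sequentially"
    using eventually_gt_at_top[of 0]
  proof eventually_elim
    case (elim m)
    have "0 \<le> ln (real (P m)) / real m" by (simp add: ln_of_nat_nonneg)
    with elim upper[of m] show ?case by simp
  qed
qed

theorem theorem4p8:
  fixes V :: "nat \<Rightarrow> bit"
  assumes "\<exists>n\<ge>1. spacer_rank n V"
  shows "has_topological_entropy (subshift V) 0"
proof -
  from assms obtain n where "at_most_spacer_rank n V"
    unfolding spacer_rank_def by blast
  then show ?thesis
    unfolding has_topological_entropy_def
    by (intro zero_growth_rate[of _ n])
      (meson card_subwords_le le_trans num_words_subshift_le)
qed

end
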